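(* For the families $E_i^{[s,t]}$, $i=0,\dots,24$, of two-dimensional real evolution algebras described in the context, let $\mathcal T=\{(s,t):0\le s\le t\}$ and let $\mathcal T^{(i)}_{nil}$ be the set of $(s,t)\in\mathcal T$ such that $E_i^{[s,t]}$ has a unique absolute nilpotent element. Then: (1) The families $E_i^{[s,t]}$, $i=3,4,5,9,10,17,22,23,24$, have the unique absolute nilpotent element $(0,0)$ for any time $(s,t)\in\mathcal T$. (2) The families $E_i^{[s,t]}$, $i=0,1,2,16,19$, have infinitely many absolute nilpotent elements for any time $(s,t)\in\mathcal T$. (3) The families $E_i^{[s,t]}$, $i=6,7,8,11,12,13,14,15,18,20,21$, have "uniqueness of absolute nilpotent element" property transition, with the following property duration sets: $$\mathcal T^{(i)}_{nil}=\{(s,t)\in\mathcal T: t<a\},\quad a>0,\qquad i=6,7,8,11,18;$$ $$\mathcal T^{(12)}_{nil}=\left\{(s,t)\in\mathcal T: g_{12}^2(s)\le\tfrac1{h_{12}^2(s)}\right\};\qquad \mathcal T^{(13)}_{nil}=\{(s,t)\in\mathcal T: s\le t<a,\ \psi_{13}^2(s)\le1\};$$ $$\mathcal T^{(14)}_{nil}=\{(s,t)\in\mathcal T:\Phi(s)\psi_{14}(s)>0\};\qquad \mathcal T^{(15)}_{nil}=\{(s,t)\in\mathcal T: s\le t<a,\ \psi_{15}(s)>0\};$$ $$\mathcal T^{(20)}_{nil}=\{(s,t)\in\mathcal T: s\le t<b\}\cup\left\{(s,t)\in\mathcal T: t\ge b,\ \tfrac{w(s)}{\Phi(s)}>0\right\};$$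 $$\mathcal T^{(21)}_{nil}=\{(s,t)\in\mathcal T: s\le t<\min\{a,b\}\}\cup\{(s,t)\in\mathcal T: b\le t<a,\ b<a,\ v(s)>0\}.$$
   Context: A two-dimensional real evolution algebra with matrix of structural constants $\mathcal M=(a_{ij})_{i,j=1,2}$ is $\mathbb R^2$ with basis $e_1,e_2$ and bilinear commutative multiplication $e_ie_i=\sum_j a_{ij}e_j$, $e_1e_2=e_2e_1=0$. An element $x$ of an algebra is absolute nilpotent if $x^2=0$ (so $0$ always is). A family of algebras indexed by $(s,t)\in\mathcal T$ has $P$ property transition if it has property $P$ at some pair of times and fails to have it at some other pair; the set of pairs at which $P$ holds is the duration of $P$. For $0\le s\le t$, $E_i^{[s,t]}$ denotes the evolution algebra with structural matrix $\mathcal M_i^{[s,t]}$ given below. Here $a,b>0$ are real constants; all parameter functions are real functions on $[0,\infty)$; $\Phi,\Psi,h_{10},h_{12},\psi_{16},\psi_{17},\psi_{18},\theta$ are nowhere zero, and no condition is stated for the other parameter functions (subscripts only distinguish the parameter functions of different families). Write $p=\Phi(t)/\Phi(s)$ and $q=\Psi(t)/\Psi(s)$; $\begin{pmatrix}x&y\\ z&w\end{pmatrix}$ is a matrix with first row $(x,y)$. - $\mathcal M_0=0$; $\mathcal M_1=\frac12\begin{pmatrix}q&-q\\ -q&q\end{pmatrix}$; $\mathcal M_2=\frac12\begin{pmatrix}1&-1\\ -1&1\end{pmatrix}$ if $t<b$, $0$ if $t\ge b$; $\mathcal M_3=\frac12\begin{pmatrix}p&p\\ p&p\end{pmatrix}$;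 $\mathcal M_4=\frac12\begin{pmatrix}p+q&p-q\\ p-q&p+q\end{pmatrix}$. - $\mathcal M_5=\frac12\begin{pmatrix}p+1&p-1\\ p-1&p+1\end{pmatrix}$ if $t<b$, $\frac12\begin{pmatrix}p&p\\ p&p\end{pmatrix}$ if $t\ge b$. - $\mathcal M_6=\frac12\begin{pmatrix}1&1\\ 1&1\end{pmatrix}$ if $t<a$, $0$ if $t\ge a$. - $\mathcal M_7=\frac12\begin{pmatrix}1+q&1-q\\ 1-q&1+q\end{pmatrix}$ if $t<a$, $\frac12\begin{pmatrix}q&-q\\ -q&q\end{pmatrix}$ if $t\ge a$. - $\mathcal M_8=\begin{pmatrix}1&0\\ 0&1\end{pmatrix}$ if $t<\min\{a,b\}$; $\frac12\begin{pmatrix}1&-1\\ -1&1\end{pmatrix}$ if $a\le t<b$; $\frac12\begin{pmatrix}1&1\\ 1&1\end{pmatrix}$ if $b\le t<a$; $0$ if $t\ge\max\{a,b\}$. - $\mathcal M_9=\begin{pmatrix}\cos(t-s)&\sin(t-s)\\ -\sin(t-s)&\cos(t-s)\end{pmatrix}$. - $\mathcal M_{10}=\frac1{2h_{10}(s)}\begin{pmatrix}h_{10}(t)+g_{10}(t)&h_{10}(t)-g_{10}(t)\\ h_{10}(t)+g_{10}(t)&h_{10}(t)-g_{10}(t)\end{pmatrix}$. - $\mathcal M_{11}=\frac12\begin{pmatrix}1+\psi_{11}(t)&1-\psi_{11}(t)\\ 1+\psi_{11}(t)&1-\psi_{11}(t)\end{pmatrix}$ if $t<a$, $0$ if $t\ge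 a$. - $\mathcal M_{12}=\frac{h_{12}(t)}2\begin{pmatrix}\frac1{h_{12}(s)}+g_{12}(s)&\frac1{h_{12}(s)}+g_{12}(s)\\ \frac1{h_{12}(s)}-g_{12}(s)&\frac1{h_{12}(s)}-g_{12}(s)\end{pmatrix}$. - $\mathcal M_{13}=\frac12\begin{pmatrix}1+\psi_{13}(s)&1+\psi_{13}(s)\\ 1-\psi_{13}(s)&1-\psi_{13}(s)\end{pmatrix}$ if $t<a$, $0$ if $t\ge a$. - $\mathcal M_{14}=\begin{pmatrix}p&0\\ \Phi(t)\psi_{14}(s)&0\end{pmatrix}$. - $\mathcal M_{15}=\begin{pmatrix}1&0\\ \psi_{15}(s)&0\end{pmatrix}$ if $t<a$, $0$ if $t\ge a$. - $\mathcal M_{16}=\begin{pmatrix}0&0\\ \frac{g_{16}(t)}{\psi_{16}(s)}&\frac{\psi_{16}(t)}{\psi_{16}(s)}\end{pmatrix}$. - $\mathcal M_{17}=\begin{pmatrix}p&0\\ \frac{\Phi(t)}{\psi_{17}(s)}(g_{17}(t)-g_{17}(s))&\frac{\psi_{17}(t)}{\psi_{17}(s)}\end{pmatrix}$. - $\mathcal M_{18}=\begin{pmatrix}1&0\\ \frac{h_{18}(t)-h_{18}(s)}{\psi_{18}(s)}&\frac{\psi_{18}(t)}{\psi_{18}(s)}\end{pmatrix}$ if $t<a$, $\begin{pmatrix}0&0\\ \frac{h_{18}(t)}{\psi_{18}(s)}&\frac{\psi_{18}(t)}{\psi_{18}(s)}\end{pmatrix}$ if $t\ge a$. - $\mathcal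 M_{19}=\begin{pmatrix}0&0\\ h_{19}(t)&1\end{pmatrix}$ if $t<b$, $0$ if $t\ge b$. - $\mathcal M_{20}=\begin{pmatrix}p&0\\ \Phi(t)(v(t)-v(s))&1\end{pmatrix}$ if $t<b$, $\begin{pmatrix}p&0\\ \Phi(t)w(s)&0\end{pmatrix}$ if $t\ge b$. - $\mathcal M_{21}=\begin{pmatrix}1&0\\ v(t)-v(s)&1\end{pmatrix}$ if $t<\min\{a,b\}$; $\begin{pmatrix}1&0\\ v(s)&0\end{pmatrix}$ if $b\le t<a$; $\begin{pmatrix}0&0\\ v(t)&1\end{pmatrix}$ if $a\le t<b$; $0$ if $t\ge\max\{a,b\}$. - $\mathcal M_{22}=\begin{pmatrix}f(t)&1-f(t)\\ f(t)&1-f(t)\end{pmatrix}$. - $\mathcal M_{23}=\mathcal M_{23}(\lambda,\mu)=\begin{pmatrix}1-\frac{\lambda-2\mu}{2(\lambda-\mu)}(1-r)&\frac{\lambda-2\mu}{2(\lambda-\mu)}(1-r)\\ \frac{\lambda}{2(\lambda-\mu)}(1-r)&1-\frac{\lambda}{2(\lambda-\mu)}(1-r)\end{pmatrix}$ with $r=\theta(t)/\theta(s)$ and real $\lambda\ne\mu$. - $\mathcal M_{24}=\begin{pmatrix}1&0\\ 0&1\end{pmatrix}$ if $t<a$, $\begin{pmatrix}g_{24}(t)&1-g_{24}(t)\\ g_{24}(t)&1-g_{24}(t)\end{pmatrix}$ if $t\ge a$.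
   Formalization: The duration sets of families 12 and 13 are proved with strict < (the printed ≤ holds iff equality never occurs), and the property transition of families 12, 13, 14, 15, 20 is proved as an equivalence with an explicit condition on the parameter functions, since it can fail otherwise. *)

theory Defs
  imports "HOL-Analysis.Analysis"
begin

section \<open>Two-dimensional real evolution algebras\<close>

text \<open>An algebra structure on the plane is given by its multiplication.\<close>

type_synonym plane_algebra = "real^2 \<Rightarrow> real^2 \<Rightarrow> real^2"

definition basis_product :: "real^2^2 \<Rightarrow> 2 \<Rightarrow> 2 \<Rightarrow> real^2" where
  "basis_product M i k = (if i = k then (\<Sum>j\<in>UNIV. M $ i $ j *\<^sub>R axis j 1) else 0)"

definition evolution_algebra :: "real^2^2 \<Rightarrow> plane_algebra" where
  "evolution_algebra M x y = (\<Sum>i\<in>UNIV. \<Sum>k\<in>UNIV. (x $ i * y $ k) *\<^sub>R basis_product M i k)"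

lemma bilinear_evolution_algebra: "bilinear (evolution_algebra M)"
  unfolding bilinear_def evolution_algebra_def
  by (auto intro!: linearI
      simp: sum_2 distrib_left distrib_right scaleR_right_distrib scaleR_left_distrib mult.assoc mult.left_commute)

lemma evolution_algebra_commute: "evolution_algebra M x y = evolution_algebra M y x"
  by (simp add: evolution_algebra_def basis_product_def sum_2 mult.commute)

lemma evolution_algebra_basis: "evolution_algebra M (axis i 1) (axis k 1) = basis_product M i k"
  using exhaust_2[of i] exhaust_2[of k]
  by (auto simp: evolution_algebra_def sum_2 axis_def)

definition absolute_nilpotent :: "plane_algebra \<Rightarrow> real^2 \<Rightarrow> bool" where
  "absolute_nilpotent A x \<longleftrightarrow> A x x = 0"

definition unique_absolute_nilpotent :: "plane_algebra \<Rightarrow> bool" where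
  "unique_absolute_nilpotent A \<longleftrightarrow> (\<exists>!x. absolute_nilpotent A x)"

section \<open>Families of algebras indexed by pairs of times\<close>

definition time_pairs :: "(real \<times> real) set" where
  "time_pairs = {(s, t). 0 \<le> s \<and> s \<le> t}"

definition property_duration ::
    "(plane_algebra \<Rightarrow> bool) \<Rightarrow> (real \<Rightarrow> real \<Rightarrow> plane_algebra) \<Rightarrow> (real \<times> real) set" where
  "property_duration P E = {(s, t). (s, t) \<in> time_pairs \<and> P (E s t)}"

definition has_property_transition ::
    "(plane_algebra \<Rightarrow> bool) \<Rightarrow> (real \<Rightarrow> real \<Rightarrow> plane_algebra) \<Rightarrow> bool" where
  "has_property_transition P E \<longleftrightarrow>
     (\<exists>(s, t) \<in> time_pairs. P (E s t)) \<and> (\<exists>(s, t) \<in> time_pairs. \<not> P (E s t))"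

definition algebra_family :: "(real \<Rightarrow> real \<Rightarrow> real^2^2) \<Rightarrow> real \<Rightarrow> real \<Rightarrow> plane_algebra" where
  "algebra_family M s t = evolution_algebra (M s t)"

abbreviation nil_duration :: "(real \<Rightarrow> real \<Rightarrow> real^2^2) \<Rightarrow> (real \<times> real) set" where
  "nil_duration M \<equiv> property_duration unique_absolute_nilpotent (algebra_family M)"

abbreviation nil_transition :: "(real \<Rightarrow> real \<Rightarrow> real^2^2) \<Rightarrow> bool" where
  "nil_transition M \<equiv> has_property_transition unique_absolute_nilpotent (algebra_family M)"

section \<open>The families of structural matrices\<close>

text \<open>Parameter functions on the nonnegative half-line are rendered as total functions; on
  \<open>time_pairs\<close> only their values at nonnegative arguments matter.\<close>

abbreviation mat2 :: "real \<Rightarrow> real \<Rightarrow> real \<Rightarrow> real \<Rightarrow> real^2^2" where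
  "mat2 x y z w \<equiv> vector [vector [x, y], vector [z, w]]"

definition M0 :: "real \<Rightarrow> real \<Rightarrow> real^2^2" where
  "M0 s t = 0"

definition M1 :: "(real \<Rightarrow> real) \<Rightarrow> real \<Rightarrow> real \<Rightarrow> real^2^2" where
  "M1 \<Psi> s t = (let q = \<Psi> t / \<Psi> s in (1/2) *\<^sub>R mat2 q (-q) (-q) q)"

definition M2 :: "real \<Rightarrow> real \<Rightarrow> real \<Rightarrow> real^2^2" where
  "M2 b s t = (if t < b then (1/2) *\<^sub>R mat2 1 (-1) (-1) 1 else 0)"

definition M3 :: "(real \<Rightarrow> real) \<Rightarrow> real \<Rightarrow> real \<Rightarrow> real^2^2" where
  "M3 \<Phi> s t = (let p = \<Phi> t / \<Phi> s in (1/2) *\<^sub>R mat2 p p p p)"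

definition M4 :: "(real \<Rightarrow> real) \<Rightarrow> (real \<Rightarrow> real) \<Rightarrow> real \<Rightarrow> real \<Rightarrow> real^2^2" where
  "M4 \<Phi> \<Psi> s t = (let p = \<Phi> t / \<Phi> s; q = \<Psi> t / \<Psi> s in
     (1/2) *\<^sub>R mat2 (p + q) (p - q) (p - q) (p + q))"

definition M5 :: "real \<Rightarrow> (real \<Rightarrow> real) \<Rightarrow> real \<Rightarrow> real \<Rightarrow> real^2^2" where
  "M5 b \<Phi> s t = (let p = \<Phi> t / \<Phi> s in
     if t < b then (1/2) *\<^sub>R mat2 (p + 1) (p - 1) (p - 1) (p + 1)
     else (1/2) *\<^sub>R mat2 p p p p)"

definition M6 :: "real \<Rightarrow> real \<Rightarrow> real \<Rightarrow> real^2^2" where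
  "M6 a s t = (if t < a then (1/2) *\<^sub>R mat2 1 1 1 1 else 0)"

definition M7 :: "real \<Rightarrow> (real \<Rightarrow> real) \<Rightarrow> real \<Rightarrow> real \<Rightarrow> real^2^2" where
  "M7 a \<Psi> s t = (let q = \<Psi> t / \<Psi> s in
     if t < a then (1/2) *\<^sub>R mat2 (1 + q) (1 - q) (1 - q) (1 + q)
     else (1/2) *\<^sub>R mat2 q (-q) (-q) q)"

definition M8 :: "real \<Rightarrow> real \<Rightarrow> real \<Rightarrow> real \<Rightarrow> real^2^2" where
  "M8 a b s t =
    (if t < min a b then mat2 1 0 0 1
     else if a \<le> t \<and> t < b then (1/2) *\<^sub>R mat2 1 (-1) (-1) 1
     else if b \<le> t \<and> t < a then (1/2) *\<^sub>R mat2 1 1 1 1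
     else 0)"

definition M9 :: "real \<Rightarrow> real \<Rightarrow> real^2^2" where
  "M9 s t = mat2 (cos (t - s)) (sin (t - s)) (- sin (t - s)) (cos (t - s))"

definition M10 :: "(real \<Rightarrow> real) \<Rightarrow> (real \<Rightarrow> real) \<Rightarrow> real \<Rightarrow> real \<Rightarrow> real^2^2" where
  "M10 h g s t = (1 / (2 * h s)) *\<^sub>R mat2 (h t + g t) (h t - g t) (h t + g t) (h t - g t)"

definition M11 :: "real \<Rightarrow> (real \<Rightarrow> real) \<Rightarrow> real \<Rightarrow> real \<Rightarrow> real^2^2" where
  "M11 a \<psi> s t =
    (if t < a then (1/2) *\<^sub>R mat2 (1 + \<psi> t) (1 - \<psi> t) (1 + \<psi> t) (1 - \<psi> t) else 0)"

definition M12 :: "(real \<Rightarrow> real) \<Rightarrow> (real \<Rightarrow> real) \<Rightarrow> real \<Rightarrow> real \<Rightarrow> real^2^2" where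
  "M12 h g s t = (h t / 2) *\<^sub>R
     mat2 (1 / h s + g s) (1 / h s + g s) (1 / h s - g s) (1 / h s - g s)"

definition M13 :: "real \<Rightarrow> (real \<Rightarrow> real) \<Rightarrow> real \<Rightarrow> real \<Rightarrow> real^2^2" where
  "M13 a \<psi> s t =
    (if t < a then (1/2) *\<^sub>R mat2 (1 + \<psi> s) (1 + \<psi> s) (1 - \<psi> s) (1 - \<psi> s) else 0)"

definition M14 :: "(real \<Rightarrow> real) \<Rightarrow> (real \<Rightarrow> real) \<Rightarrow> real \<Rightarrow> real \<Rightarrow> real^2^2" where
  "M14 \<Phi> \<psi> s t = mat2 (\<Phi> t / \<Phi> s) 0 (\<Phi> t * \<psi> s) 0"

definition M15 :: "real \<Rightarrow> (real \<Rightarrow> real) \<Rightarrow> real \<Rightarrow> real \<Rightarrow> real^2^2" where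
  "M15 a \<psi> s t = (if t < a then mat2 1 0 (\<psi> s) 0 else 0)"

definition M16 :: "(real \<Rightarrow> real) \<Rightarrow> (real \<Rightarrow> real) \<Rightarrow> real \<Rightarrow> real \<Rightarrow> real^2^2" where
  "M16 \<psi> g s t = mat2 0 0 (g t / \<psi> s) (\<psi> t / \<psi> s)"

definition M17 ::
    "(real \<Rightarrow> real) \<Rightarrow> (real \<Rightarrow> real) \<Rightarrow> (real \<Rightarrow> real) \<Rightarrow> real \<Rightarrow> real \<Rightarrow> real^2^2" where
  "M17 \<Phi> \<psi> g s t =
     mat2 (\<Phi> t / \<Phi> s) 0 (\<Phi> t / \<psi> s * (g t - g s)) (\<psi> t / \<psi> s)"

definition M18 :: "real \<Rightarrow> (real \<Rightarrow> real) \<Rightarrow> (real \<Rightarrow> real) \<Rightarrow> real \<Rightarrow> real \<Rightarrow> real^2^2" where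
  "M18 a \<psi> h s t =
    (if t < a then mat2 1 0 ((h t - h s) / \<psi> s) (\<psi> t / \<psi> s)
     else mat2 0 0 (h t / \<psi> s) (\<psi> t / \<psi> s))"

definition M19 :: "real \<Rightarrow> (real \<Rightarrow> real) \<Rightarrow> real \<Rightarrow> real \<Rightarrow> real^2^2" where
  "M19 b h s t = (if t < b then mat2 0 0 (h t) 1 else 0)"

definition M20 ::
    "real \<Rightarrow> (real \<Rightarrow> real) \<Rightarrow> (real \<Rightarrow> real) \<Rightarrow> (real \<Rightarrow> real) \<Rightarrow> real \<Rightarrow> real \<Rightarrow> real^2^2" where
  "M20 b \<Phi> v w s t =
    (if t < b then mat2 (\<Phi> t / \<Phi> s) 0 (\<Phi> t * (v t - v s)) 1
     else mat2 (\<Phi> t / \<Phi> s) 0 (\<Phi> t * w s) 0)"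

definition M21 :: "real \<Rightarrow> real \<Rightarrow> (real \<Rightarrow> real) \<Rightarrow> real \<Rightarrow> real \<Rightarrow> real^2^2" where
  "M21 a b v s t =
    (if t < min a b then mat2 1 0 (v t - v s) 1
     else if b \<le> t \<and> t < a then mat2 1 0 (v s) 0
     else if a \<le> t \<and> t < b then mat2 0 0 (v t) 1
     else 0)"

definition M22 :: "(real \<Rightarrow> real) \<Rightarrow> real \<Rightarrow> real \<Rightarrow> real^2^2" where
  "M22 f s t = mat2 (f t) (1 - f t) (f t) (1 - f t)"

definition M23 :: "real \<Rightarrow> real \<Rightarrow> (real \<Rightarrow> real) \<Rightarrow> real \<Rightarrow> real \<Rightarrow> real^2^2" where
  "M23 lam \<mu> \<theta> s t = (let r = \<theta> t / \<theta> s in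
     mat2 (1 - (lam - 2 * \<mu>) / (2 * (lam - \<mu>)) * (1 - r))
          ((lam - 2 * \<mu>) / (2 * (lam - \<mu>)) * (1 - r))
          (lam / (2 * (lam - \<mu>)) * (1 - r))
          (1 - lam / (2 * (lam - \<mu>)) * (1 - r)))"

definition M24 :: "real \<Rightarrow> (real \<Rightarrow> real) \<Rightarrow> real \<Rightarrow> real \<Rightarrow> real^2^2" where
  "M24 a g s t =
    (if t < a then mat2 1 0 0 1 else mat2 (g t) (1 - g t) (g t) (1 - g t))"

end

theory Submission
  imports Defs
begin

text \<open>Squaring in the algebra of \<open>M\<close> depends only on \<open>(x\<^sub>1\<^sup>2, x\<^sub>2\<^sup>2)\<close>, which ranges over the closed
  first quadrant: absolute nilpotents are the solutions there of the linear system with matrix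
  \<open>M\<^sup>T\<close>. They form a cone, so there is either one or infinitely many. If \<open>det M \<noteq> 0\<close> there is one;
  every singular nonzero matrix is an outer product of \<open>(\<alpha>, \<beta>)\<close> with some \<open>(c, d) \<noteq> 0\<close>, and the
  system reduces to \<open>\<alpha> x\<^sub>1\<^sup>2 + \<beta> x\<^sub>2\<^sup>2 = 0\<close>, which has only the trivial solution iff \<open>\<alpha> \<beta> > 0\<close>.\<close>

section \<open>The absolute nilpotent elements of a single evolution algebra\<close>

lemma mat2_nth [simp]:
  "mat2 x y z w $ 1 $ 1 = x" "mat2 x y z w $ 1 $ 2 = y"
  "mat2 x y z w $ 2 $ 1 = z" "mat2 x y z w $ 2 $ 2 = w"
  by (simp_all add: vector_2)

lemma scaleR_mat2: "k *\<^sub>R mat2 x y z w = mat2 (k * x) (k * y) (k * z) (k * w)"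
  by (simp add: vec_eq_iff forall_2)

lemma absolute_nilpotent_evolution_algebra_iff:
  "absolute_nilpotent (evolution_algebra M) x \<longleftrightarrow>
     M $ 1 $ 1 * (x $ 1)\<^sup>2 + M $ 2 $ 1 * (x $ 2)\<^sup>2 = 0 \<and>
     M $ 1 $ 2 * (x $ 1)\<^sup>2 + M $ 2 $ 2 * (x $ 2)\<^sup>2 = 0"
  by (simp add: absolute_nilpotent_def evolution_algebra_def basis_product_def sum_2
      vec_eq_iff forall_2 axis_def power2_eq_square algebra_simps)

lemma absolute_nilpotent_zero: "absolute_nilpotent (evolution_algebra M) 0"
  by (simp add: absolute_nilpotent_evolution_algebra_iff)

lemma absolute_nilpotent_scaleR:
  assumes "absolute_nilpotent (evolution_algebra M) x"
  shows "absolute_nilpotent (evolution_algebra M) (k *\<^sub>R x)"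
proof -
  have "evolution_algebra M (k *\<^sub>R x) (k *\<^sub>R x) = (k * k) *\<^sub>R evolution_algebra M x x"
    using bilinear_evolution_algebra[of M] by (simp add: bilinear_lmul bilinear_rmul)
  then show ?thesis
    using assms by (simp add: absolute_nilpotent_def)
qed

lemma unique_absolute_nilpotent_iff:
  "unique_absolute_nilpotent (evolution_algebra M) \<longleftrightarrow>
     (\<forall>x. absolute_nilpotent (evolution_algebra M) x \<longrightarrow> x = 0)"
  unfolding unique_absolute_nilpotent_def using absolute_nilpotent_zero[of M] by metis

lemma absolute_nilpotent_singleton_iff:
  "{x. absolute_nilpotent (evolution_algebra M) x} = {0} \<longleftrightarrow>
     unique_absolute_nilpotent (evolution_algebra M)"
  unfolding unique_absolute_nilpotent_iff set_eq_iff mem_Collect_eq singleton_iff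
  using absolute_nilpotent_zero[of M] by metis

text \<open>A nonzero absolute nilpotent drags its whole line along, so a set other than {0} is
  already infinite. Claims of infinitude thus reduce to failure of uniqueness.\<close>

lemma infinite_absolute_nilpotent_iff:
  "infinite {x. absolute_nilpotent (evolution_algebra M) x} \<longleftrightarrow>
     \<not> unique_absolute_nilpotent (evolution_algebra M)"
proof
  assume "infinite {x. absolute_nilpotent (evolution_algebra M) x}"
  then have "{x. absolute_nilpotent (evolution_algebra M) x} \<noteq> {0}"
    by (metis finite.emptyI finite_insert)
  then show "\<not> unique_absolute_nilpotent (evolution_algebra M)"
    unfolding absolute_nilpotent_singleton_iff .
next
  assume "\<not> unique_absolute_nilpotent (evolution_algebra M)"
  then obtain x where x: "absolute_nilpotent (evolution_algebra M) x" "x \<noteq> 0"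
    unfolding unique_absolute_nilpotent_iff by blast
  have "inj (\<lambda>k::real. k *\<^sub>R x)"
    using x(2) by (auto simp: inj_on_def)
  then have "infinite (range (\<lambda>k::real. k *\<^sub>R x))"
    by (simp add: finite_image_iff infinite_UNIV_char_0)
  moreover have "range (\<lambda>k::real. k *\<^sub>R x) \<subseteq> {x. absolute_nilpotent (evolution_algebra M) x}"
    using absolute_nilpotent_scaleR[OF x(1)] by auto
  ultimately show "infinite {x. absolute_nilpotent (evolution_algebra M) x}"
    using finite_subset by blast
qed

section \<open>Two uniqueness criteria: nonzero determinant and outer products\<close>

lemma unique_absolute_nilpotent_mat2_det:
  assumes "x * w - y * z \<noteq> 0"
  shows "unique_absolute_nilpotent (evolution_algebra (mat2 x y z w))"
proof -
  have "X = 0" if X: "absolute_nilpotent (evolution_algebra (mat2 x y z w)) X" for X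
  proof -
    define u v where "u = (X $ 1)\<^sup>2" and "v = (X $ 2)\<^sup>2"
    have e: "x * u + z * v = 0" "y * u + w * v = 0"
      using X by (simp_all add: absolute_nilpotent_evolution_algebra_iff u_def v_def)
    \<comment> \<open>Cramer's rule: each unknown is eliminated from the two equations in
      turn.\<close>
    have "(x * w - y * z) * u = 0" "(x * w - y * z) * v = 0"
      using e by algebra+
    with assms have "u = 0" "v = 0" by simp_all
    then show ?thesis by (simp add: u_def v_def vec_eq_iff forall_2)
  qed
  then show ?thesis
    unfolding unique_absolute_nilpotent_iff by blast
qed

lemma unique_absolute_nilpotent_mat2_outer:
  assumes "c \<noteq> 0 \<or> d \<noteq> 0"
  shows "unique_absolute_nilpotent (evolution_algebra (mat2 (\<alpha> * c) (\<alpha> * d) (\<beta> * c) (\<beta> * d)))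
           \<longleftrightarrow> \<alpha> * \<beta> > 0"
proof -
  let ?A = "evolution_algebra (mat2 (\<alpha> * c) (\<alpha> * d) (\<beta> * c) (\<beta> * d))"
  have nil: "absolute_nilpotent ?A X \<longleftrightarrow> \<alpha> * (X $ 1)\<^sup>2 + \<beta> * (X $ 2)\<^sup>2 = 0" for X
  proof -
    have "\<alpha> * k * (X $ 1)\<^sup>2 + \<beta> * k * (X $ 2)\<^sup>2 = k * (\<alpha> * (X $ 1)\<^sup>2 + \<beta> * (X $ 2)\<^sup>2)" for k
      by (simp add: algebra_simps)
    then show ?thesis
      using assms by (auto simp: absolute_nilpotent_evolution_algebra_iff)
  qed
  show ?thesis
  proof
    assume uniq: "unique_absolute_nilpotent ?A"
    show "\<alpha> * \<beta> > 0"
    proof (rule ccontr)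
      assume neg: "\<not> \<alpha> * \<beta> > 0"
      \<comment> \<open>If \<open>\<alpha> = 0\<close> the first coordinate is unconstrained.
        Otherwise the squares are |\<beta>| and |\<alpha>|; as the signs of \<alpha> and \<beta> do
        not agree, the two terms cancel, and the second coordinate is nonzero.\<close>
      define X :: "real^2" where
        "X = (if \<alpha> = 0 then vector [1, 0] else vector [sqrt \<bar>\<beta>\<bar>, sqrt \<bar>\<alpha>\<bar>])"
      have "\<alpha> * \<bar>\<beta>\<bar> + \<beta> * \<bar>\<alpha>\<bar> = 0"
        using neg by (auto simp: abs_if zero_less_mult_iff)
      then have "absolute_nilpotent ?A X"
        by (simp add: nil X_def)
      then have "X = 0"
        using uniq unfolding unique_absolute_nilpotent_iff by blast
      then show False
        by (auto simp: X_def vec_eq_iff forall_2 split: if_splits)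
    qed
  next
    assume "\<alpha> * \<beta> > 0"
    \<comment> \<open>Multiplying the equation by \<alpha> makes both coefficients positive,
      whatever the common sign of \<alpha> and \<beta>; a vanishing sum of nonnegative terms then
      forces both squares to be 0.\<close>
    then have pos: "\<alpha> * \<alpha> > 0" "\<alpha> * \<beta> > 0"
      by (auto simp: zero_less_mult_iff)
    have "X = 0" if "absolute_nilpotent ?A X" for X
    proof -
      have "\<alpha> * \<alpha> * (X $ 1)\<^sup>2 + \<alpha> * \<beta> * (X $ 2)\<^sup>2 = \<alpha> * (\<alpha> * (X $ 1)\<^sup>2 + \<beta> * (X $ 2)\<^sup>2)"
        by (simp add: algebra_simps)
      also have "\<dots> = 0" using that by (simp add: nil)
      finally have "\<alpha> * \<alpha> * (X $ 1)\<^sup>2 = 0 \<and> \<alpha> * \<beta> * (X $ 2)\<^sup>2 = 0"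
        using pos by (simp add: add_nonneg_eq_0_iff)
      with pos show ?thesis by (auto simp: vec_eq_iff forall_2)
    qed
    then show "unique_absolute_nilpotent ?A"
      unfolding unique_absolute_nilpotent_iff by blast
  qed
qed

lemma not_unique_absolute_nilpotent_zero: "\<not> unique_absolute_nilpotent (evolution_algebra 0)"
proof -
  have "absolute_nilpotent (evolution_algebra 0) (axis 1 1)"
    by (simp add: absolute_nilpotent_evolution_algebra_iff)
  moreover have "axis 1 1 \<noteq> (0 :: real^2)"
    by (simp add: axis_eq_0_iff)
  ultimately show ?thesis
    unfolding unique_absolute_nilpotent_iff by blast
qed

section \<open>The criteria carried over to families indexed by times\<close>

abbreviation unique_nil :: "(real \<Rightarrow> real \<Rightarrow> real^2^2) \<Rightarrow> real \<Rightarrow> real \<Rightarrow> bool" where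
  "unique_nil M s t \<equiv> unique_absolute_nilpotent (algebra_family M s t)"

text \<open>The matrix enters through an equation, so that a family can be rewritten into the
  required shape at the given times, branch by branch.\<close>

lemma unique_nil_det:
  assumes "M s t = mat2 x y z w" "x * w - y * z \<noteq> 0"
  shows "unique_nil M s t"
  using unique_absolute_nilpotent_mat2_det[OF assms(2)] assms(1) by (simp add: algebra_family_def)

lemma unique_nil_outer:
  assumes "M s t = mat2 (\<alpha> * c) (\<alpha> * d) (\<beta> * c) (\<beta> * d)" "c \<noteq> 0 \<or> d \<noteq> 0"
  shows "unique_nil M s t \<longleftrightarrow> \<alpha> * \<beta> > 0"
  using unique_absolute_nilpotent_mat2_outer[OF assms(2)] assms(1) by (simp add: algebra_family_def)

lemma not_unique_nil_zero: "M s t = 0 \<Longrightarrow> \<not> unique_nil M s t"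
  by (simp add: algebra_family_def not_unique_absolute_nilpotent_zero)

lemma absolute_nilpotents_eq_zero_iff:
  "{x. absolute_nilpotent (algebra_family M s t) x} = {0} \<longleftrightarrow> unique_nil M s t"
  by (simp only: algebra_family_def absolute_nilpotent_singleton_iff)

lemma infinite_absolute_nilpotents_iff:
  "infinite {x. absolute_nilpotent (algebra_family M s t) x} \<longleftrightarrow> \<not> unique_nil M s t"
  by (simp only: algebra_family_def infinite_absolute_nilpotent_iff)

section \<open>Uniqueness family by family\<close>

lemma unique_nil_M0:
  "\<not> unique_nil M0 s t"
  by (simp add: not_unique_nil_zero M0_def)

lemma unique_nil_M1:
  assumes "\<Psi> s \<noteq> 0" "\<Psi> t \<noteq> 0"
  shows "\<not> unique_nil (M1 \<Psi>) s t"
  \<comment> \<open>The last four arguments are \<alpha>, c, d, \<beta>, here and below. The second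
    row is the negative of the first, hence \<open>\<alpha> * \<beta> = - 1\<close>.\<close>
  using unique_nil_outer[of "M1 \<Psi>" s t 1 "\<Psi> t / \<Psi> s / 2" "- (\<Psi> t / \<Psi> s / 2)" "- 1"] assms
  by (simp add: M1_def Let_def scaleR_mat2)

lemma unique_nil_M2:
  "\<not> unique_nil (M2 b) s t"
proof (cases "t < b")
  case True
  then show ?thesis
    using unique_nil_outer[of "M2 b" s t 1 "1 / 2" "- 1 / 2" "- 1"]
    by (simp add: M2_def scaleR_mat2)
qed (simp add: not_unique_nil_zero M2_def)

lemma unique_nil_M3:
  assumes "\<Phi> s \<noteq> 0" "\<Phi> t \<noteq> 0"
  shows "unique_nil (M3 \<Phi>) s t"
  using unique_nil_outer[of "M3 \<Phi>" s t 1 "\<Phi> t / \<Phi> s / 2" "\<Phi> t / \<Phi> s / 2" 1] assms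
  by (simp add: M3_def Let_def scaleR_mat2)

text \<open>The vectors (1, 1) and (1, -1) are eigenvectors with eigenvalues p and q, so the
  determinant is p q.\<close>

lemma unique_nil_M4:
  assumes "\<Phi> s \<noteq> 0" "\<Phi> t \<noteq> 0" "\<Psi> s \<noteq> 0" "\<Psi> t \<noteq> 0"
  shows "unique_nil (M4 \<Phi> \<Psi>) s t"
proof (rule unique_nil_det)
  define p q where "p = \<Phi> t / \<Phi> s" and "q = \<Psi> t / \<Psi> s"
  show "M4 \<Phi> \<Psi> s t = mat2 ((p + q) / 2) ((p - q) / 2) ((p - q) / 2) ((p + q) / 2)"
    by (simp add: M4_def Let_def scaleR_mat2 p_def q_def)
  have "(p + q) / 2 * ((p + q) / 2) - (p - q) / 2 * ((p - q) / 2) = p * q"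
    by (simp add: field_simps)
  then show "(p + q) / 2 * ((p + q) / 2) - (p - q) / 2 * ((p - q) / 2) \<noteq> 0"
    using assms by (simp add: p_def q_def)
qed

lemma unique_nil_M5:
  assumes "\<Phi> s \<noteq> 0" "\<Phi> t \<noteq> 0"
  shows "unique_nil (M5 b \<Phi>) s t"
proof (cases "t < b")
  case True
  \<comment> \<open>A constant \<Psi> gives q = 1.\<close>
  then have "M5 b \<Phi> s t = M4 \<Phi> (\<lambda>_. 1) s t"
    by (simp add: M5_def M4_def Let_def)
  then show ?thesis
    using unique_nil_M4[of \<Phi> s t "\<lambda>_. 1"] assms by (simp add: algebra_family_def)
next
  case False
  then have "M5 b \<Phi> s t = M3 \<Phi> s t"
    by (simp add: M5_def M3_def)
  then show ?thesis
    using unique_nil_M3[of \<Phi> s t] assms by (simp add: algebra_family_def)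
qed

lemma unique_nil_M6_iff:
  "unique_nil (M6 a) s t \<longleftrightarrow> t < a"
proof (cases "t < a")
  case True
  then show ?thesis
    using unique_nil_outer[of "M6 a" s t 1 "1 / 2" "1 / 2" 1]
    by (simp add: M6_def scaleR_mat2)
qed (simp add: not_unique_nil_zero M6_def)

lemma unique_nil_M7_iff:
  assumes "\<Psi> s \<noteq> 0" "\<Psi> t \<noteq> 0"
  shows "unique_nil (M7 a \<Psi>) s t \<longleftrightarrow> t < a"
proof (cases "t < a")
  case True
  then have "M7 a \<Psi> s t = M4 (\<lambda>_. 1) \<Psi> s t"
    by (simp add: M7_def M4_def Let_def)
  then show ?thesis
    using unique_nil_M4[of "\<lambda>_. 1" s t \<Psi>] assms True by (simp add: algebra_family_def)
next
  case False
  then have "M7 a \<Psi> s t = M1 \<Psi> s t"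
    by (simp add: M7_def M1_def)
  then show ?thesis
    using unique_nil_M1[of \<Psi> s t] assms False by (simp add: algebra_family_def)
qed

text \<open>The identity is the sum of the projections onto (1, 1) and (1, -1). The first vanishes
  from time a on, the second from time b on. Alone, the first has \<alpha> \<beta> = 1 and the
  second \<alpha> \<beta> = -1, so only a matters.\<close>

lemma unique_nil_M8_iff:
  "unique_nil (M8 a b) s t \<longleftrightarrow> t < a"
proof -
  consider "t < min a b" | "a \<le> t" "t < b" | "b \<le> t" "t < a" | "max a b \<le> t"
    by linarith
  then show ?thesis
  proof cases
    case 1
    then show ?thesis
      using unique_nil_det[of "M8 a b" s t 1 0 0 1] by (simp add: M8_def)
  next
    case 2
    then show ?thesis
      using unique_nil_outer[of "M8 a b" s t 1 "1 / 2" "- 1 / 2" "- 1"]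
      by (simp add: M8_def scaleR_mat2)
  next
    case 3
    then show ?thesis
      using unique_nil_outer[of "M8 a b" s t 1 "1 / 2" "1 / 2" 1]
      by (simp add: M8_def scaleR_mat2)
  next
    case 4
    then show ?thesis
      by (simp add: not_unique_nil_zero M8_def)
  qed
qed

lemma unique_nil_M9:
  "unique_nil M9 s t"
  \<comment> \<open>The determinant of a rotation is cos^2 + sin^2 = 1.\<close>
  by (rule unique_nil_det[OF M9_def]) (simp flip: power2_eq_square)

text \<open>Equal rows give \<alpha> \<beta> = 1. The common row is nonzero because its entries add
  up to \<open>h t / h s\<close>. \<open>M11\<close> before its cutoff and \<open>M22\<close> work
  alike, with row sum 1.\<close>

lemma unique_nil_M10:
  assumes "h s \<noteq> 0" "h t \<noteq> 0"
  shows "unique_nil (M10 h g) s t"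
  using unique_nil_outer[of "M10 h g" s t 1 "(h t + g t) / (2 * h s)" "(h t - g t) / (2 * h s)" 1]
    assms by (auto simp: M10_def scaleR_mat2)

lemma unique_nil_M11_iff:
  "unique_nil (M11 a \<psi>) s t \<longleftrightarrow> t < a"
proof (cases "t < a")
  case True
  then show ?thesis
    using unique_nil_outer[of "M11 a \<psi>" s t 1 "(1 + \<psi> t) / 2" "(1 - \<psi> t) / 2" 1]
    by (auto simp: M11_def scaleR_mat2)
qed (simp add: not_unique_nil_zero M11_def)

text \<open>The rows are multiples of (1, 1) with factors proportional to
  \<open>1 / h s + g s\<close> and \<open>1 / h s - g s\<close>. The inequality is strict because at
  equality one of these factors vanishes and uniqueness is lost.\<close>

lemma unique_nil_M12_iff:
  assumes "h t \<noteq> 0"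
  shows "unique_nil (M12 h g) s t \<longleftrightarrow> (g s)\<^sup>2 < 1 / (h s)\<^sup>2"
proof -
  have "unique_nil (M12 h g) s t \<longleftrightarrow> (1 / h s + g s) * (1 / h s - g s) > 0"
    using assms by (intro unique_nil_outer[where c = "h t / 2" and d = "h t / 2"])
      (auto simp: M12_def scaleR_mat2 mult.commute)
  also have "(1 / h s + g s) * (1 / h s - g s) = 1 / (h s)\<^sup>2 - (g s)\<^sup>2"
    by (simp add: algebra_simps power2_eq_square)
  finally show ?thesis by simp
qed

lemma unique_nil_M13_iff:
  "unique_nil (M13 a \<psi>) s t \<longleftrightarrow> t < a \<and> (\<psi> s)\<^sup>2 < 1"
proof (cases "t < a")
  case True
  \<comment> \<open>Again rows along (1, 1), with factors \<open>1 + \<psi> s\<close> and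
    \<open>1 - \<psi> s\<close>; at \<open>(\<psi> s)\<^sup>2 = 1\<close> one row is zero.\<close>
  then have "unique_nil (M13 a \<psi>) s t \<longleftrightarrow> (1 + \<psi> s) * (1 - \<psi> s) > 0"
    by (intro unique_nil_outer[where c = "1 / 2" and d = "1 / 2"])
      (auto simp: M13_def scaleR_mat2)
  also have "(1 + \<psi> s) * (1 - \<psi> s) = 1 - (\<psi> s)\<^sup>2"
    by (simp add: algebra_simps power2_eq_square)
  finally show ?thesis using True by simp
qed (simp add: not_unique_nil_zero M13_def)

lemma unique_nil_M14_iff:
  assumes "\<Phi> t \<noteq> 0"
  shows "unique_nil (M14 \<Phi> \<psi>) s t \<longleftrightarrow> \<Phi> s * \<psi> s > 0"
proof -
  have "unique_nil (M14 \<Phi> \<psi>) s t \<longleftrightarrow> 1 / \<Phi> s * \<psi> s > 0"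
    using assms by (intro unique_nil_outer[where c = "\<Phi> t" and d = 0])
      (auto simp: M14_def mult.commute)
  \<comment> \<open>A number and its reciprocal have the same sign; at \<open>\<Phi> s = 0\<close>
    both sides are false, since division by zero yields 0.\<close>
  also have "\<dots> \<longleftrightarrow> \<Phi> s * \<psi> s > 0"
    by (auto simp: zero_less_divide_iff zero_less_mult_iff)
  finally show ?thesis .
qed

lemma unique_nil_M15_iff:
  "unique_nil (M15 a \<psi>) s t \<longleftrightarrow> t < a \<and> \<psi> s > 0"
proof (cases "t < a")
  case True
  then show ?thesis
    using unique_nil_outer[of "M15 a \<psi>" s t 1 1 0 "\<psi> s"] by (simp add: M15_def)
qed (simp add: not_unique_nil_zero M15_def)

lemma unique_nil_M16:
  assumes "\<psi> s \<noteq> 0" "\<psi> t \<noteq> 0"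
  shows "\<not> unique_nil (M16 \<psi> g) s t"
  \<comment> \<open>The first row is zero, so \<alpha> = 0; the entry
    \<open>\<psi> t / \<psi> s\<close> keeps (c, d) nonzero.\<close>
  using unique_nil_outer[of "M16 \<psi> g" s t 0 "g t / \<psi> s" "\<psi> t / \<psi> s" 1] assms
  by (simp add: M16_def)

lemma unique_nil_M17:
  assumes "\<Phi> s \<noteq> 0" "\<Phi> t \<noteq> 0" "\<psi> s \<noteq> 0" "\<psi> t \<noteq> 0"
  shows "unique_nil (M17 \<Phi> \<psi> g) s t"
  \<comment> \<open>Triangular matrix: the determinant is the product of the diagonal
    entries.\<close>
  by (rule unique_nil_det[OF M17_def]) (use assms in simp)

lemma unique_nil_M18_iff:
  assumes "\<psi> s \<noteq> 0" "\<psi> t \<noteq> 0"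
  shows "unique_nil (M18 a \<psi> h) s t \<longleftrightarrow> t < a"
proof (cases "t < a")
  case True
  then show ?thesis
    using unique_nil_det[of "M18 a \<psi> h" s t 1 0 "(h t - h s) / \<psi> s" "\<psi> t / \<psi> s"] assms
    by (simp add: M18_def)
next
  case False
  then have "M18 a \<psi> h s t = M16 \<psi> h s t"
    by (simp add: M18_def M16_def)
  then show ?thesis
    using unique_nil_M16[of \<psi> s t] assms False by (simp add: algebra_family_def)
qed

lemma unique_nil_M19:
  "\<not> unique_nil (M19 b h) s t"
proof (cases "t < b")
  case True
  then show ?thesis
    using unique_nil_outer[of "M19 b h" s t 0 "h t" 1 1] by (simp add: M19_def)
qed (simp add: not_unique_nil_zero M19_def)

text \<open>Before b the matrix is triangular and invertible; from b on it is that of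
  \<open>M14\<close>, with w in place of \<psi>.\<close>

lemma unique_nil_M20_iff:
  assumes "\<Phi> s \<noteq> 0" "\<Phi> t \<noteq> 0"
  shows "unique_nil (M20 b \<Phi> v w) s t \<longleftrightarrow> t < b \<or> w s / \<Phi> s > 0"
proof (cases "t < b")
  case True
  then show ?thesis
    using unique_nil_det[of "M20 b \<Phi> v w" s t "\<Phi> t / \<Phi> s" 0 "\<Phi> t * (v t - v s)" 1] assms
    by (simp add: M20_def)
next
  case False
  then have "M20 b \<Phi> v w s t = M14 \<Phi> w s t"
    by (simp add: M20_def M14_def)
  then have "unique_nil (M20 b \<Phi> v w) s t \<longleftrightarrow> \<Phi> s * w s > 0"
    using unique_nil_M14_iff[of \<Phi> t] assms(2) by (simp add: algebra_family_def)
  also have "\<dots> \<longleftrightarrow> w s / \<Phi> s > 0"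
    by (auto simp: zero_less_divide_iff zero_less_mult_iff)
  finally show ?thesis using False by simp
qed

text \<open>The four regimes are: invertible triangular; zero second column with row factors 1 and
  \<open>v s\<close>; zero first row; zero matrix.\<close>

lemma unique_nil_M21_iff:
  "unique_nil (M21 a b v) s t \<longleftrightarrow> t < min a b \<or> b \<le> t \<and> t < a \<and> v s > 0"
proof -
  consider "t < min a b" | "b \<le> t" "t < a" | "a \<le> t" "t < b" | "max a b \<le> t"
    by linarith
  then show ?thesis
  proof cases
    case 1
    then show ?thesis
      using unique_nil_det[of "M21 a b v" s t 1 0 "v t - v s" 1] by (simp add: M21_def)
  next
    case 2
    then show ?thesis
      using unique_nil_outer[of "M21 a b v" s t 1 1 0 "v s"] by (simp add: M21_def)
  next
    case 3
    then show ?thesis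
      using unique_nil_outer[of "M21 a b v" s t 0 "v t" 1 1] by (simp add: M21_def)
  next
    case 4
    then show ?thesis
      by (simp add: not_unique_nil_zero M21_def)
  qed
qed

lemma unique_nil_M22:
  "unique_nil (M22 f) s t"
  using unique_nil_outer[of "M22 f" s t 1 "f t" "1 - f t" 1] by (auto simp: M22_def)

text \<open>Rows sum to 1, so 1 is an eigenvalue; the other is r, hence the determinant is
  r.\<close>

lemma unique_nil_M23:
  assumes "lam \<noteq> \<mu>" "\<theta> s \<noteq> 0" "\<theta> t \<noteq> 0"
  shows "unique_nil (M23 lam \<mu> \<theta>) s t"
proof (rule unique_nil_det)
  define r k l where "r = \<theta> t / \<theta> s"
    and "k = (lam - 2 * \<mu>) / (2 * (lam - \<mu>))" and "l = lam / (2 * (lam - \<mu>))"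
  show "M23 lam \<mu> \<theta> s t = mat2 (1 - k * (1 - r)) (k * (1 - r)) (l * (1 - r)) (1 - l * (1 - r))"
    by (simp add: M23_def Let_def r_def k_def l_def)
  \<comment> \<open>The numerators add up to twice lam - \<mu>, which is nonzero, and this makes the
    determinant collapse to r.\<close>
  have "k + l = (2 * (lam - \<mu>)) / (2 * (lam - \<mu>))"
    unfolding k_def l_def by (simp flip: add_divide_distrib)
  then have "k + l = 1"
    using assms(1) by simp
  have "(1 - k * (1 - r)) * (1 - l * (1 - r)) - k * (1 - r) * (l * (1 - r)) = 1 - (k + l) * (1 - r)"
    by (simp add: algebra_simps)
  also have "\<dots> = r"
    by (simp add: \<open>k + l = 1\<close>)
  finally show "(1 - k * (1 - r)) * (1 - l * (1 - r)) - k * (1 - r) * (l * (1 - r)) \<noteq> 0"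
    using assms by (simp add: r_def)
qed

lemma unique_nil_M24:
  "unique_nil (M24 a g) s t"
proof (cases "t < a")
  case True
  then show ?thesis
    using unique_nil_det[of "M24 a g" s t 1 0 0 1] by (simp add: M24_def)
next
  case False
  then have "M24 a g s t = M22 g s t"
    by (simp add: M24_def M22_def)
  then show ?thesis
    using unique_nil_M22[of g s t] by (simp add: algebra_family_def)
qed

section \<open>Duration sets and property transitions\<close>

lemma nil_duration_eqI:
  assumes "\<And>s t. 0 \<le> s \<Longrightarrow> s \<le> t \<Longrightarrow> unique_nil M s t \<longleftrightarrow> (s, t) \<in> D" "D \<subseteq> time_pairs"
  shows "nil_duration M = D"
  using assms by (auto simp: property_duration_def time_pairs_def)

lemma nil_transition_iff:
  assumes "\<And>s t. 0 \<le> s \<Longrightarrow> s \<le> t \<Longrightarrow> unique_nil M s t \<longleftrightarrow> Q s t"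
  shows "nil_transition M \<longleftrightarrow> (\<exists>s\<ge>0. \<exists>t\<ge>s. Q s t) \<and> (\<exists>s\<ge>0. \<exists>t\<ge>s. \<not> Q s t)"
  using assms by (fastforce simp: has_property_transition_def time_pairs_def)

text \<open>Decides when the non-strict inequality describes the same duration as the strict one,
  for \<open>M12\<close> and \<open>M13\<close>. By the assumption on C, equality at an admissible s
  is always visible at the diagonal pair (s, s).\<close>

lemma time_pairs_less_eq_le_iff:
  fixes F G :: "real \<Rightarrow> real"
  assumes "\<And>s t. s \<le> t \<Longrightarrow> C s t \<Longrightarrow> C s s"
  shows "{(s, t) \<in> time_pairs. C s t \<and> F s < G s} = {(s, t) \<in> time_pairs. C s t \<and> F s \<le> G s}
           \<longleftrightarrow> (\<forall>s\<ge>0. C s s \<longrightarrow> F s \<noteq> G s)" (is "?L = ?R \<longleftrightarrow> _")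
proof
  assume eq: "?L = ?R"
  show "\<forall>s\<ge>0. C s s \<longrightarrow> F s \<noteq> G s"
  proof (intro allI impI notI)
    fix s assume s: "0 \<le> s" "C s s" "F s = G s"
    then have "(s, s) \<in> ?R" by (simp add: time_pairs_def)
    then have "(s, s) \<in> ?L" unfolding eq .
    with s show False by simp
  qed
next
  assume ne: "\<forall>s\<ge>0. C s s \<longrightarrow> F s \<noteq> G s"
  have "F s < G s \<longleftrightarrow> F s \<le> G s" if "(s, t) \<in> time_pairs" "C s t" for s t
  proof -
    have "F s \<noteq> G s"
      using ne assms[of s t] that by (simp add: time_pairs_def)
    then show ?thesis by linarith
  qed
  then show "?L = ?R" by (intro Collect_cong) (simp split: prod.split cong: conj_cong)
qed

text \<open>For \<open>M12\<close> and \<open>M13\<close> the true durations carry strict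
  inequalities; the non-strict sets are correct exactly when equality never occurs at a relevant s.
  The free parameter functions of \<open>M12\<close> to \<open>M15\<close> and \<open>M20\<close>
  can rule out a transition (for instance g12 = 0 makes uniqueness permanent), so an exact criterion
  for the transition stands there.\<close>

theorem theorem5p1:
  fixes a b lam \<mu> :: real
    and \<Phi> \<Psi> h10 g10 \<psi>11 h12 g12 \<psi>13 \<psi>14 \<psi>15 \<psi>16 g16 \<psi>17 g17 \<psi>18 h18 h19 v w f \<theta> g24
      :: "real \<Rightarrow> real"
  assumes "a > 0" and "b > 0" and "lam \<noteq> \<mu>"
    and "\<And>t. t \<ge> 0 \<Longrightarrow> \<Phi> t \<noteq> 0" and "\<And>t. t \<ge> 0 \<Longrightarrow> \<Psi> t \<noteq> 0"
    and "\<And>t. t \<ge> 0 \<Longrightarrow> h10 t \<noteq> 0" and "\<And>t. t \<ge> 0 \<Longrightarrow> h12 t \<noteq> 0"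
    and "\<And>t. t \<ge> 0 \<Longrightarrow> \<psi>16 t \<noteq> 0" and "\<And>t. t \<ge> 0 \<Longrightarrow> \<psi>17 t \<noteq> 0"
    and "\<And>t. t \<ge> 0 \<Longrightarrow> \<psi>18 t \<noteq> 0" and "\<And>t. t \<ge> 0 \<Longrightarrow> \<theta> t \<noteq> 0"
  shows
    "(\<forall>M \<in> {M3 \<Phi>, M4 \<Phi> \<Psi>, M5 b \<Phi>, M9, M10 h10 g10, M17 \<Phi> \<psi>17 g17, M22 f,
             M23 lam \<mu> \<theta>, M24 a g24}.
        \<forall>(s, t) \<in> time_pairs. {x. absolute_nilpotent (algebra_family M s t) x} = {0})
     \<and>
     (\<forall>M \<in> {M0, M1 \<Psi>, M2 b, M16 \<psi>16 g16, M19 b h19}.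
        \<forall>(s, t) \<in> time_pairs. infinite {x. absolute_nilpotent (algebra_family M s t) x})
     \<and>
     (\<forall>M \<in> {M6 a, M7 a \<Psi>, M8 a b, M11 a \<psi>11, M18 a \<psi>18 h18}.
        nil_transition M \<and> nil_duration M = {(s, t) \<in> time_pairs. t < a})
     \<and>
     (nil_transition (M12 h12 g12) \<longleftrightarrow>
        (\<exists>s\<ge>0. (g12 s)\<^sup>2 < 1 / (h12 s)\<^sup>2) \<and> (\<exists>s\<ge>0. (g12 s)\<^sup>2 \<ge> 1 / (h12 s)\<^sup>2))
     \<and>
     nil_duration (M12 h12 g12) = {(s, t) \<in> time_pairs. (g12 s)\<^sup>2 < 1 / (h12 s)\<^sup>2}
     \<and>
     (nil_duration (M12 h12 g12) = {(s, t) \<in> time_pairs. (g12 s)\<^sup>2 \<le> 1 / (h12 s)\<^sup>2} \<longleftrightarrow>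
        (\<forall>s\<ge>0. (g12 s)\<^sup>2 \<noteq> 1 / (h12 s)\<^sup>2))
     \<and>
     (nil_transition (M13 a \<psi>13) \<longleftrightarrow> (\<exists>s\<ge>0. s < a \<and> (\<psi>13 s)\<^sup>2 < 1))
     \<and>
     nil_duration (M13 a \<psi>13) = {(s, t) \<in> time_pairs. s \<le> t \<and> t < a \<and> (\<psi>13 s)\<^sup>2 < 1}
     \<and>
     (nil_duration (M13 a \<psi>13) = {(s, t) \<in> time_pairs. s \<le> t \<and> t < a \<and> (\<psi>13 s)\<^sup>2 \<le> 1} \<longleftrightarrow>
        (\<forall>s\<ge>0. s < a \<longrightarrow> (\<psi>13 s)\<^sup>2 \<noteq> 1))
     \<and>
     (nil_transition (M14 \<Phi> \<psi>14) \<longleftrightarrow>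
        (\<exists>s\<ge>0. \<Phi> s * \<psi>14 s > 0) \<and> (\<exists>s\<ge>0. \<Phi> s * \<psi>14 s \<le> 0))
     \<and>
     nil_duration (M14 \<Phi> \<psi>14) = {(s, t) \<in> time_pairs. \<Phi> s * \<psi>14 s > 0}
     \<and>
     (nil_transition (M15 a \<psi>15) \<longleftrightarrow> (\<exists>s\<ge>0. s < a \<and> \<psi>15 s > 0))
     \<and>
     nil_duration (M15 a \<psi>15) = {(s, t) \<in> time_pairs. s \<le> t \<and> t < a \<and> \<psi>15 s > 0}
     \<and>
     (nil_transition (M20 b \<Phi> v w) \<longleftrightarrow> (\<exists>s\<ge>0. w s / \<Phi> s \<le> 0))
     \<and>
     nil_duration (M20 b \<Phi> v w) =
        {(s, t) \<in> time_pairs. s \<le> t \<and> t < b} \<union> {(s, t) \<in> time_pairs. t \<ge> b \<and> w s / \<Phi> s > 0}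
     \<and>
     nil_transition (M21 a b v)
     \<and>
     nil_duration (M21 a b v) =
        {(s, t) \<in> time_pairs. s \<le> t \<and> t < min a b} \<union>
        {(s, t) \<in> time_pairs. b \<le> t \<and> t < a \<and> b < a \<and> v s > 0}"
proof -
  have nz: "\<Phi> s \<noteq> 0" "\<Phi> t \<noteq> 0" "\<Psi> s \<noteq> 0" "\<Psi> t \<noteq> 0" "h10 s \<noteq> 0" "h10 t \<noteq> 0" "h12 t \<noteq> 0"
      "\<psi>16 s \<noteq> 0" "\<psi>16 t \<noteq> 0" "\<psi>17 s \<noteq> 0" "\<psi>17 t \<noteq> 0" "\<psi>18 s \<noteq> 0" "\<psi>18 t \<noteq> 0"
      "\<theta> s \<noteq> 0" "\<theta> t \<noteq> 0" if "0 \<le> s" "s \<le> t" for s t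
    using that assms(4-11) by auto
  \<comment> \<open>Past a cutoff uniqueness fails for \<open>M13\<close> and \<open>M15\<close>, so
    their transition only requires one pair with uniqueness; t = s is the best choice for
    it.\<close>
  have late: "\<exists>t\<ge>s. \<not> (t < c \<and> Q)" for s c :: real and Q
    by (rule exI[of _ "max s c"]) auto
  have early: "(\<exists>t\<ge>s. t < c \<and> Q) \<longleftrightarrow> s < c \<and> Q" for s c :: real and Q
    by auto
  have at0: "\<exists>s\<ge>0. \<exists>t\<ge>s. t < c" if "0 < c" for c :: real
    using that by auto
  have A: "unique_nil M s t"
    if "M \<in> {M3 \<Phi>, M4 \<Phi> \<Psi>, M5 b \<Phi>, M9, M10 h10 g10, M17 \<Phi> \<psi>17 g17, M22 f, M23 lam \<mu> \<theta>, M24 a g24}"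
      "0 \<le> s" "s \<le> t" for M s t
    using that(1) nz[OF that(2,3)] assms(3)
    by (elim insertE) (simp_all add: unique_nil_M3 unique_nil_M4 unique_nil_M5 unique_nil_M9
        unique_nil_M10 unique_nil_M17 unique_nil_M22 unique_nil_M23 unique_nil_M24)
  have B: "\<not> unique_nil M s t"
    if "M \<in> {M0, M1 \<Psi>, M2 b, M16 \<psi>16 g16, M19 b h19}" "0 \<le> s" "s \<le> t" for M s t
    using that(1) nz[OF that(2,3)]
    by (elim insertE) (simp_all add: unique_nil_M0 unique_nil_M1 unique_nil_M2 unique_nil_M16
        unique_nil_M19)
  have C: "unique_nil M s t \<longleftrightarrow> t < a"
    if "M \<in> {M6 a, M7 a \<Psi>, M8 a b, M11 a \<psi>11, M18 a \<psi>18 h18}" "0 \<le> s" "s \<le> t" for M s t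
    using that(1) nz[OF that(2,3)]
    by (elim insertE) (simp_all add: unique_nil_M6_iff unique_nil_M7_iff unique_nil_M8_iff
        unique_nil_M11_iff unique_nil_M18_iff)
  have tC: "nil_transition M"
    if "M \<in> {M6 a, M7 a \<Psi>, M8 a b, M11 a \<psi>11, M18 a \<psi>18 h18}" for M
    using at0[OF assms(1)] late[of 0 a True]
    by (subst nil_transition_iff[where Q = "\<lambda>_ t. t < a"]) (use C[OF that] in auto)
  have t12: "nil_transition (M12 h12 g12) \<longleftrightarrow>
      (\<exists>s\<ge>0. (g12 s)\<^sup>2 < 1 / (h12 s)\<^sup>2) \<and> (\<exists>s\<ge>0. (g12 s)\<^sup>2 \<ge> 1 / (h12 s)\<^sup>2)"
    by (subst nil_transition_iff[where Q = "\<lambda>s _. (g12 s)\<^sup>2 < 1 / (h12 s)\<^sup>2"])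
      (auto simp: unique_nil_M12_iff nz not_less)
  have d12: "nil_duration (M12 h12 g12) = {(s, t) \<in> time_pairs. (g12 s)\<^sup>2 < 1 / (h12 s)\<^sup>2}"
    by (rule nil_duration_eqI) (auto simp: unique_nil_M12_iff time_pairs_def nz)
  have e12: "nil_duration (M12 h12 g12) = {(s, t) \<in> time_pairs. (g12 s)\<^sup>2 \<le> 1 / (h12 s)\<^sup>2} \<longleftrightarrow>
      (\<forall>s\<ge>0. (g12 s)\<^sup>2 \<noteq> 1 / (h12 s)\<^sup>2)"
    \<comment> \<open>Here every pair is admissible; for \<open>M13\<close> below, admissible means
      t < a, which passes from t to s.\<close>
    unfolding d12
    using time_pairs_less_eq_le_iff[of "\<lambda>_ _. True" "\<lambda>s. (g12 s)\<^sup>2" "\<lambda>s. 1 / (h12 s)\<^sup>2"] by simp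
  have t13: "nil_transition (M13 a \<psi>13) \<longleftrightarrow> (\<exists>s\<ge>0. s < a \<and> (\<psi>13 s)\<^sup>2 < 1)"
    by (subst nil_transition_iff[OF unique_nil_M13_iff]) (unfold early, use late[of 0 a] in auto)
  have d13: "nil_duration (M13 a \<psi>13) = {(s, t) \<in> time_pairs. s \<le> t \<and> t < a \<and> (\<psi>13 s)\<^sup>2 < 1}"
    by (rule nil_duration_eqI) (auto simp: unique_nil_M13_iff time_pairs_def)
  have e13: "nil_duration (M13 a \<psi>13) =
        {(s, t) \<in> time_pairs. s \<le> t \<and> t < a \<and> (\<psi>13 s)\<^sup>2 \<le> 1} \<longleftrightarrow>
      (\<forall>s\<ge>0. s < a \<longrightarrow> (\<psi>13 s)\<^sup>2 \<noteq> 1)"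
    unfolding d13
    using time_pairs_less_eq_le_iff[of "\<lambda>s t. s \<le> t \<and> t < a" "\<lambda>s. (\<psi>13 s)\<^sup>2" "\<lambda>_. 1"] by simp
  have t14: "nil_transition (M14 \<Phi> \<psi>14) \<longleftrightarrow>
      (\<exists>s\<ge>0. \<Phi> s * \<psi>14 s > 0) \<and> (\<exists>s\<ge>0. \<Phi> s * \<psi>14 s \<le> 0)"
    by (subst nil_transition_iff[where Q = "\<lambda>s _. \<Phi> s * \<psi>14 s > 0"])
      (auto simp: unique_nil_M14_iff nz not_less)
  have d14: "nil_duration (M14 \<Phi> \<psi>14) = {(s, t) \<in> time_pairs. \<Phi> s * \<psi>14 s > 0}"
    by (rule nil_duration_eqI) (auto simp: unique_nil_M14_iff time_pairs_def nz)
  have t15: "nil_transition (M15 a \<psi>15) \<longleftrightarrow> (\<exists>s\<ge>0. s < a \<and> \<psi>15 s > 0)"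
    by (subst nil_transition_iff[OF unique_nil_M15_iff]) (unfold early, use late[of 0 a] in auto)
  have d15: "nil_duration (M15 a \<psi>15) = {(s, t) \<in> time_pairs. s \<le> t \<and> t < a \<and> \<psi>15 s > 0}"
    by (rule nil_duration_eqI) (auto simp: unique_nil_M15_iff time_pairs_def)
  have t20: "nil_transition (M20 b \<Phi> v w) \<longleftrightarrow> (\<exists>s\<ge>0. w s / \<Phi> s \<le> 0)"
  proof -
    have "nil_transition (M20 b \<Phi> v w) \<longleftrightarrow>
        (\<exists>s\<ge>0. \<exists>t\<ge>s. t < b \<or> w s / \<Phi> s > 0) \<and> (\<exists>s\<ge>0. \<exists>t\<ge>s. \<not> (t < b \<or> w s / \<Phi> s > 0))"
      by (rule nil_transition_iff) (simp add: unique_nil_M20_iff assms(4))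
    moreover have "\<exists>s\<ge>0. \<exists>t\<ge>s. t < b \<or> w s / \<Phi> s > 0"
      using at0[OF assms(2)] by blast
    \<comment> \<open>For large t the cutoff alternative is gone and only the sign condition at s is
      left.\<close>
    moreover have "(\<exists>t\<ge>s. \<not> (t < b \<or> Q)) \<longleftrightarrow> \<not> Q" for s and Q
      using late[of s b True] by auto
    ultimately show ?thesis
      by (simp only: not_less simp_thms)
  qed
  have d20: "nil_duration (M20 b \<Phi> v w) =
      {(s, t) \<in> time_pairs. s \<le> t \<and> t < b} \<union> {(s, t) \<in> time_pairs. t \<ge> b \<and> w s / \<Phi> s > 0}"
    by (rule nil_duration_eqI) (auto simp: unique_nil_M20_iff time_pairs_def assms(4))
  have t21: "nil_transition (M21 a b v)"
    \<comment> \<open>Uniqueness holds at (0, 0), before both cutoffs, and fails at (0, max a b),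
      where the matrix is zero.\<close>
    using at0[of "min a b"] late[of 0 "max a b" True] assms(1,2)
    by (subst nil_transition_iff[OF unique_nil_M21_iff]) fastforce
  have d21: "nil_duration (M21 a b v) =
      {(s, t) \<in> time_pairs. s \<le> t \<and> t < min a b} \<union>
      {(s, t) \<in> time_pairs. b \<le> t \<and> t < a \<and> b < a \<and> v s > 0}"
    by (rule nil_duration_eqI) (auto simp: unique_nil_M21_iff time_pairs_def)
  have "\<forall>M \<in> {M3 \<Phi>, M4 \<Phi> \<Psi>, M5 b \<Phi>, M9, M10 h10 g10, M17 \<Phi> \<psi>17 g17, M22 f,
             M23 lam \<mu> \<theta>, M24 a g24}.
        \<forall>(s, t) \<in> time_pairs. {x. absolute_nilpotent (algebra_family M s t) x} = {0}"
    using A unfolding absolute_nilpotents_eq_zero_iff time_pairs_def by blast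
  moreover have "\<forall>M \<in> {M0, M1 \<Psi>, M2 b, M16 \<psi>16 g16, M19 b h19}.
        \<forall>(s, t) \<in> time_pairs. infinite {x. absolute_nilpotent (algebra_family M s t) x}"
    using B unfolding infinite_absolute_nilpotents_iff time_pairs_def by blast
  moreover have "\<forall>M \<in> {M6 a, M7 a \<Psi>, M8 a b, M11 a \<psi>11, M18 a \<psi>18 h18}.
        nil_transition M \<and> nil_duration M = {(s, t) \<in> time_pairs. t < a}"
  proof (intro ballI conjI)
    fix M assume M: "M \<in> {M6 a, M7 a \<Psi>, M8 a b, M11 a \<psi>11, M18 a \<psi>18 h18}"
    show "nil_transition M" by (rule tC[OF M])
    show "nil_duration M = {(s, t) \<in> time_pairs. t < a}"
      using C[OF M] by (intro nil_duration_eqI) (auto simp: time_pairs_def)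
  qed
  ultimately show ?thesis
    using t12 d12 e12 t13 d13 e13 t14 d14 t15 d15 t20 d20 t21 d21 by (intro conjI)
qed

end
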